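(* Let $X$ and $Y$ be topological spaces. If $X$ and $Y$ are homeomorphic, then $\mathrm{Pg}_n(X)\cong_{WL}\mathrm{Pg}_n(Y)$ for all $n\in(\mathbb{N}\cup\{\infty\})\setminus\{0\}$.
   Context: Covers and posets. Let $X$ be a nonempty topological space and let $p=(X_i)_i$ be an open covering of $X$, i.e. a collection of open subsets of $X$ with union $X$, not containing $\emptyset$. For $x\in X$ let $h(x):=\{X_t\in (X_i)_i : x\in X_t\}$, and write $x\sim_p y$ iff $h(x)=h(y)$. The quotient $X/\!\sim_p$ is a poset under $[x]\le[y]$ iff $h(x)\subseteq h(y)$. The covering is called admissible if $X/\!\sim_p$ is at most countably infinite. Graphs. To the poset $P=X/\!\sim_p$ assign the directed graph (again denoted $X/\!\sim_p$) with vertex set $P$ and an edge $(x,y)$ exactly when $x<y$ and there is no $z\in P$ with $x<z<y$. For $X=\emptyset$, by convention the only cover considered is $\{\emptyset\}$ (one element), and it is assigned the graph with one vertex and no edges. $C^*$-algebras. $C^*(G)$ denotes the graph $C^*$-algebra of a countable directed graph $G$, i.e. the universal $C^*$-algebra generated by a Cuntz–Krieger $G$-family (one of the standard conventions being fixed throughout); it is unique up to $*$-isomorphism. $\mathrm{Prim}\,A$ is the set of primitive ideals (kernels of irreducible representations) of a $C^*$-algebra $A$, with the Jacobson (hull-kernel) topology. Spaces. For a topological space $Z$, $C_b(Z)$ is the $C^*$-algebra of bounded continuous complex-valued functions on $Z$, and $\mathfrak{C}$ is the sheaf $\mathfrak{C}(U):=C_b(U)$, $U$ open in $Z$, with the usual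 restriction maps. A $C^*$-algebraic space is a topological space together with a sheaf on it with values in the category of $C^*$-algebras and $*$-homomorphisms; morphisms and isomorphisms of $C^*$-algebraic spaces are defined as for ringed spaces. Each $\mathrm{Prim}\,A$ is regarded as a $C^*$-algebraic space with the sheaf $\mathfrak{C}$. The space $\mathrm{Pg}_n(X)$. With $A_p:=C^*(X/\!\sim_p)$, define $\mathrm{Pg}_n(X):=\bigcup_p \mathrm{Prim}(A_p)$, the union being over all admissible covers $p$ of $X$ consisting of precisely $n$ elements (countably infinitely many if $n=\infty$); it is empty if there are no such covers. It is given the smallest topology containing the collection of all sets $U$ such that $U$ is an open subset of some such $\mathrm{Prim}(A_p)$, and the sheaf $\mathfrak{C}(U)=C_b(U)$. Weak local isomorphism. $\mathrm{Pg}_n(X)\cong_{WL}\mathrm{Pg}_n(Y)$ means: (1) for every admissible cover $t$ of $X$ with precisely $n$ elements there exists at least one admissible cover $p$ of $Y$ with precisely $n$ elements such that $\mathrm{Prim}(C^*(X/\!\sim_t))\cong \mathrm{Prim}(C^*(Y/\!\sim_p))$ as $C^*$-algebraic spaces; and (2) the same with the roles of $X$ and $Y$ exchanged. *)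

theory Defs
  imports
    "HOL-Analysis.Analysis"
    "HOL-Algebra.Module"
    "HOL-Library.Extended_Nat"
    "Graph_Theory.Digraph"
begin

section \<open>C*-algebras\<close>

definition complex_ring :: "complex ring" where
  "complex_ring = \<lparr>carrier = UNIV, mult = (*), one = 1, zero = 0, add = (+)\<rparr>"

text \<open>C*-algebras are not assumed to be unital: the \<^const>\<open>one\<close> field inherited from the record
  of modules is never used.\<close>

record 'a cstar = "(complex, 'a) module" +
  star :: "'a \<Rightarrow> 'a"
  cnorm :: "'a \<Rightarrow> real"

text \<open>The value off the carrier is irrelevant; it makes the function symmetric everywhere, as
  \<^locale>\<open>Metric_space\<close> demands.\<close>

definition norm_dist :: "('c, 'a, 'm) module_scheme \<Rightarrow> ('a \<Rightarrow> real) \<Rightarrow> 'a \<Rightarrow> 'a \<Rightarrow> real" where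
  "norm_dist M N x y =
     (if x \<in> carrier M \<and> y \<in> carrier M then N (x \<ominus>\<^bsub>M\<^esub> y) else 0)"

locale cstar_algebra = Module.module complex_ring A for A :: "'a cstar" (structure) +
  assumes mult_closed: "\<lbrakk>x \<in> carrier A; y \<in> carrier A\<rbrakk> \<Longrightarrow> x \<otimes> y \<in> carrier A"
    and mult_assoc: "\<lbrakk>x \<in> carrier A; y \<in> carrier A; z \<in> carrier A\<rbrakk>
          \<Longrightarrow> (x \<otimes> y) \<otimes> z = x \<otimes> (y \<otimes> z)"
    and mult_distr_left: "\<lbrakk>x \<in> carrier A; y \<in> carrier A; z \<in> carrier A\<rbrakk>
          \<Longrightarrow> (x \<oplus> y) \<otimes> z = x \<otimes> z \<oplus> y \<otimes> z"
    and mult_distr_right: "\<lbrakk>x \<in> carrier A; y \<in> carrier A; z \<in> carrier A\<rbrakk>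
          \<Longrightarrow> z \<otimes> (x \<oplus> y) = z \<otimes> x \<oplus> z \<otimes> y"
    and smult_mult_left: "\<lbrakk>x \<in> carrier A; y \<in> carrier A\<rbrakk>
          \<Longrightarrow> (c \<odot> x) \<otimes> y = c \<odot> (x \<otimes> y)"
    and smult_mult_right: "\<lbrakk>x \<in> carrier A; y \<in> carrier A\<rbrakk>
          \<Longrightarrow> x \<otimes> (c \<odot> y) = c \<odot> (x \<otimes> y)"
    and star_closed: "x \<in> carrier A \<Longrightarrow> star A x \<in> carrier A"
    and star_star: "x \<in> carrier A \<Longrightarrow> star A (star A x) = x"
    and star_add: "\<lbrakk>x \<in> carrier A; y \<in> carrier A\<rbrakk>
          \<Longrightarrow> star A (x \<oplus> y) = star A x \<oplus> star A y"
    and star_smult: "x \<in> carrier A \<Longrightarrow> star A (c \<odot> x) = cnj c \<odot> star A x"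
    and star_mult: "\<lbrakk>x \<in> carrier A; y \<in> carrier A\<rbrakk>
          \<Longrightarrow> star A (x \<otimes> y) = star A y \<otimes> star A x"
    and cnorm_nonneg: "x \<in> carrier A \<Longrightarrow> 0 \<le> cnorm A x"
    and cnorm_eq_zero: "x \<in> carrier A \<Longrightarrow> cnorm A x = 0 \<longleftrightarrow> x = \<zero>"
    and cnorm_smult: "x \<in> carrier A \<Longrightarrow> cnorm A (c \<odot> x) = cmod c * cnorm A x"
    and cnorm_triangle: "\<lbrakk>x \<in> carrier A; y \<in> carrier A\<rbrakk>
          \<Longrightarrow> cnorm A (x \<oplus> y) \<le> cnorm A x + cnorm A y"
    and cnorm_mult: "\<lbrakk>x \<in> carrier A; y \<in> carrier A\<rbrakk>
          \<Longrightarrow> cnorm A (x \<otimes> y) \<le> cnorm A x * cnorm A y"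
    and cstar_identity: "x \<in> carrier A \<Longrightarrow> cnorm A (star A x \<otimes> x) = (cnorm A x)\<^sup>2"
    and complete: "Metric_space.mcomplete (carrier A) (norm_dist A (cnorm A))"

definition star_hom :: "'a cstar \<Rightarrow> 'b cstar \<Rightarrow> ('a \<Rightarrow> 'b) \<Rightarrow> bool" where
  "star_hom A B \<phi> \<longleftrightarrow>
     \<phi> \<in> carrier A \<rightarrow> carrier B \<and>
     (\<forall>x\<in>carrier A. \<forall>y\<in>carrier A. \<phi> (x \<oplus>\<^bsub>A\<^esub> y) = \<phi> x \<oplus>\<^bsub>B\<^esub> \<phi> y) \<and>
     (\<forall>c. \<forall>x\<in>carrier A. \<phi> (c \<odot>\<^bsub>A\<^esub> x) = c \<odot>\<^bsub>B\<^esub> \<phi> x) \<and>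
     (\<forall>x\<in>carrier A. \<forall>y\<in>carrier A. \<phi> (x \<otimes>\<^bsub>A\<^esub> y) = \<phi> x \<otimes>\<^bsub>B\<^esub> \<phi> y) \<and>
     (\<forall>x\<in>carrier A. \<phi> (star A x) = star B (\<phi> x))"

definition closed_star_subalgebra :: "'a set \<Rightarrow> 'a cstar \<Rightarrow> bool" where
  "closed_star_subalgebra S A \<longleftrightarrow>
     submodule S complex_ring A \<and>
     (\<forall>x\<in>S. \<forall>y\<in>S. x \<otimes>\<^bsub>A\<^esub> y \<in> S) \<and>
     (\<forall>x\<in>S. star A x \<in> S) \<and>
     closedin (Metric_space.mtopology (carrier A) (norm_dist A (cnorm A))) S"


section \<open>Primitive ideals\<close>

text \<open>The \<^const>\<open>mult\<close> and \<^const>\<open>one\<close> fields of a Hilbert space are never used.\<close>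

record 'h hilbert = "(complex, 'h) module" +
  hinner :: "'h \<Rightarrow> 'h \<Rightarrow> complex"

definition hnorm :: "'h hilbert \<Rightarrow> 'h \<Rightarrow> real" where
  "hnorm H x = sqrt (Re (hinner H x x))"

locale hilbert_space = Module.module complex_ring H for H :: "'h hilbert" (structure) +
  assumes hinner_add: "\<lbrakk>x \<in> carrier H; y \<in> carrier H; z \<in> carrier H\<rbrakk>
          \<Longrightarrow> hinner H (x \<oplus> y) z = hinner H x z + hinner H y z"
    and hinner_smult: "\<lbrakk>x \<in> carrier H; y \<in> carrier H\<rbrakk>
          \<Longrightarrow> hinner H (c \<odot> x) y = c * hinner H x y"
    and hinner_commute: "\<lbrakk>x \<in> carrier H; y \<in> carrier H\<rbrakk>
          \<Longrightarrow> hinner H y x = cnj (hinner H x y)"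
    and hinner_nonneg: "x \<in> carrier H \<Longrightarrow> 0 \<le> Re (hinner H x x)"
    and hinner_eq_zero: "x \<in> carrier H \<Longrightarrow> hinner H x x = 0 \<longleftrightarrow> x = \<zero>"
    and complete: "Metric_space.mcomplete (carrier H) (norm_dist H (hnorm H))"

definition bounded_operator :: "'h hilbert \<Rightarrow> ('h \<Rightarrow> 'h) \<Rightarrow> bool" where
  "bounded_operator H T \<longleftrightarrow>
     T \<in> carrier H \<rightarrow> carrier H \<and>
     (\<forall>x\<in>carrier H. \<forall>y\<in>carrier H. T (x \<oplus>\<^bsub>H\<^esub> y) = T x \<oplus>\<^bsub>H\<^esub> T y) \<and>
     (\<forall>c. \<forall>x\<in>carrier H. T (c \<odot>\<^bsub>H\<^esub> x) = c \<odot>\<^bsub>H\<^esub> T x) \<and>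
     (\<exists>K. \<forall>x\<in>carrier H. hnorm H (T x) \<le> K * hnorm H x)"

text \<open>*-homomorphisms from \<open>A\<close> into the bounded operators on \<open>H\<close>.\<close>

definition representation :: "'a cstar \<Rightarrow> 'h hilbert \<Rightarrow> ('a \<Rightarrow> 'h \<Rightarrow> 'h) \<Rightarrow> bool" where
  "representation A H \<pi> \<longleftrightarrow>
     hilbert_space H \<and>
     (\<forall>a\<in>carrier A. bounded_operator H (\<pi> a)) \<and>
     (\<forall>a\<in>carrier A. \<forall>b\<in>carrier A. \<forall>x\<in>carrier H. \<pi> (a \<oplus>\<^bsub>A\<^esub> b) x = \<pi> a x \<oplus>\<^bsub>H\<^esub> \<pi> b x) \<and>
     (\<forall>c. \<forall>a\<in>carrier A. \<forall>x\<in>carrier H. \<pi> (c \<odot>\<^bsub>A\<^esub> a) x = c \<odot>\<^bsub>H\<^esub> \<pi> a x) \<and>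
     (\<forall>a\<in>carrier A. \<forall>b\<in>carrier A. \<forall>x\<in>carrier H. \<pi> (a \<otimes>\<^bsub>A\<^esub> b) x = \<pi> a (\<pi> b x)) \<and>
     (\<forall>a\<in>carrier A. \<forall>x\<in>carrier H. \<forall>y\<in>carrier H.
        hinner H (\<pi> a x) y = hinner H x (\<pi> (star A a) y))"

text \<open>As usual the zero representation (also the one on a one-dimensional space) does not count
  as irreducible.\<close>

definition irreducible_representation ::
  "'a cstar \<Rightarrow> 'h hilbert \<Rightarrow> ('a \<Rightarrow> 'h \<Rightarrow> 'h) \<Rightarrow> bool" where
  "irreducible_representation A H \<pi> \<longleftrightarrow>
     representation A H \<pi> \<and>
     (\<exists>a\<in>carrier A. \<exists>x\<in>carrier H. \<pi> a x \<noteq> \<zero>\<^bsub>H\<^esub>) \<and>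
     (\<forall>V. submodule V complex_ring H \<and>
          closedin (Metric_space.mtopology (carrier H) (norm_dist H (hnorm H))) V \<and>
          (\<forall>a\<in>carrier A. \<forall>x\<in>V. \<pi> a x \<in> V)
        \<longrightarrow> V = {\<zero>\<^bsub>H\<^esub>} \<or> V = carrier H)"

definition rep_kernel :: "'a cstar \<Rightarrow> 'h hilbert \<Rightarrow> ('a \<Rightarrow> 'h \<Rightarrow> 'h) \<Rightarrow> 'a set" where
  "rep_kernel A H \<pi> = {a \<in> carrier A. \<forall>x\<in>carrier H. \<pi> a x = \<zero>\<^bsub>H\<^esub>}"

text \<open>Taking the Hilbert spaces on the type of \<open>A\<close> loses nothing: by Kadison's transitivity
  theorem an irreducible representation space is \<open>{\<pi> a \<xi> | a \<in> A}\<close> for any \<open>\<xi> \<noteq> 0\<close>, hence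
  has at most the cardinality of \<open>A\<close>.\<close>

definition Prim :: "'a cstar \<Rightarrow> 'a set set" where
  "Prim A = {rep_kernel A H \<pi> | (H :: 'a hilbert) \<pi>. irreducible_representation A H \<pi>}"

definition ideal_hull :: "'a cstar \<Rightarrow> 'a set \<Rightarrow> 'a set set" where
  "ideal_hull A I = {P \<in> Prim A. I \<subseteq> P}"

definition Prim_topology :: "'a cstar \<Rightarrow> 'a set topology" where
  "Prim_topology A = topology (\<lambda>U. \<exists>I\<subseteq>carrier A. U = Prim A - ideal_hull A I)"


section \<open>C*-algebraic spaces\<close>

text \<open>The data of a C*-algebraic space. \<open>sections S U\<close> and \<open>restr S U V\<close> (restriction from \<open>U\<close>
  to \<open>V \<subseteq> U\<close>) are meaningful for \<open>U\<close>, \<open>V\<close> open in \<open>base S\<close> only.\<close>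

record ('p, 'c) cstar_space =
  base :: "'p topology"
  sections :: "'p set \<Rightarrow> 'c cstar"
  restr :: "'p set \<Rightarrow> 'p set \<Rightarrow> 'c \<Rightarrow> 'c"

abbreviation preimg :: "('p, 'c) cstar_space \<Rightarrow> ('p \<Rightarrow> 'q) \<Rightarrow> 'q set \<Rightarrow> 'p set" where
  "preimg S f V \<equiv> {x \<in> topspace (base S). f x \<in> V}"

text \<open>A morphism \<open>S \<rightarrow> T\<close> is a continuous map \<open>f\<close> together with a morphism \<open>\<phi>\<close> from the
  sheaf of \<open>T\<close> to the direct image under \<open>f\<close> of the sheaf of \<open>S\<close>.\<close>

definition cstar_space_morphism ::
  "('p, 'c) cstar_space \<Rightarrow> ('q, 'd) cstar_space \<Rightarrow> ('p \<Rightarrow> 'q) \<Rightarrow> ('q set \<Rightarrow> 'd \<Rightarrow> 'c) \<Rightarrow> bool" where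
  "cstar_space_morphism S T f \<phi> \<longleftrightarrow>
     continuous_map (base S) (base T) f \<and>
     (\<forall>V. openin (base T) V \<longrightarrow> star_hom (sections T V) (sections S (preimg S f V)) (\<phi> V)) \<and>
     (\<forall>V W. openin (base T) V \<and> openin (base T) W \<and> W \<subseteq> V \<longrightarrow>
        (\<forall>a\<in>carrier (sections T V).
           \<phi> W (restr T V W a) = restr S (preimg S f V) (preimg S f W) (\<phi> V a)))"

text \<open>Existence of mutually inverse morphisms \<open>(f, \<phi>)\<close> and \<open>(g, \<psi>)\<close>; the last two conditions say
  that the composites act as the identity on sections.\<close>

definition cstar_space_isomorphic ::
  "('p, 'c) cstar_space \<Rightarrow> ('q, 'd) cstar_space \<Rightarrow> bool" where
  "cstar_space_isomorphic S T \<longleftrightarrow>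
     (\<exists>f \<phi> g \<psi>.
        cstar_space_morphism S T f \<phi> \<and> cstar_space_morphism T S g \<psi> \<and>
        (\<forall>x\<in>topspace (base S). g (f x) = x) \<and>
        (\<forall>y\<in>topspace (base T). f (g y) = y) \<and>
        (\<forall>V. openin (base T) V \<longrightarrow>
           (\<forall>a\<in>carrier (sections T V). \<psi> (preimg S f V) (\<phi> V a) = a)) \<and>
        (\<forall>U. openin (base S) U \<longrightarrow>
           (\<forall>b\<in>carrier (sections S U). \<phi> (preimg T g U) (\<psi> U b) = b)))"

text \<open>Functions on \<open>U\<close> are represented by their extensions by \<^const>\<open>undefined\<close>. The \<open>insert 0\<close> only
  affects \<open>U = {}\<close>, where it gives norm 0.\<close>

definition Cb :: "'p topology \<Rightarrow> 'p set \<Rightarrow> ('p \<Rightarrow> complex) cstar" where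
  "Cb Z U =
     \<lparr>carrier = {f \<in> extensional U. continuous_map (subtopology Z U) euclidean f \<and> bounded (f ` U)},
      mult = (\<lambda>f g. restrict (\<lambda>x. f x * g x) U),
      one = restrict (\<lambda>x. 1) U,
      zero = restrict (\<lambda>x. 0) U,
      add = (\<lambda>f g. restrict (\<lambda>x. f x + g x) U),
      smult = (\<lambda>c f. restrict (\<lambda>x. c * f x) U),
      star = (\<lambda>f. restrict (\<lambda>x. cnj (f x)) U),
      cnorm = (\<lambda>f. Sup (insert 0 ((\<lambda>x. cmod (f x)) ` U)))\<rparr>"

definition Cb_space :: "'p topology \<Rightarrow> ('p, 'p \<Rightarrow> complex) cstar_space" where
  "Cb_space Z = \<lparr>base = Z, sections = Cb Z, restr = (\<lambda>U V f. restrict f V)\<rparr>"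

definition Prim_space :: "'a cstar \<Rightarrow> ('a set, 'a set \<Rightarrow> complex) cstar_space" where
  "Prim_space A = Cb_space (Prim_topology A)"


section \<open>Graph C*-algebras\<close>

text \<open>The convention in which \<open>s e\<close> maps the range projection of \<open>e\<close> to a subprojection of the
  source projection, and no relation is imposed at sinks and at infinite emitters. For projections,
  \<open>s e \<otimes> star (s e) \<le> p (tail G e)\<close> is spelled out as
  \<open>p (tail G e) \<otimes> (s e \<otimes> star (s e)) = s e \<otimes> star (s e)\<close>.\<close>

definition cuntz_krieger_family ::
  "('v, 'e) pre_digraph \<Rightarrow> 'a cstar \<Rightarrow> ('v \<Rightarrow> 'a) \<Rightarrow> ('e \<Rightarrow> 'a) \<Rightarrow> bool" where
  "cuntz_krieger_family G A p s \<longleftrightarrow>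
     (\<forall>v\<in>verts G. p v \<in> carrier A \<and> p v \<otimes>\<^bsub>A\<^esub> p v = p v \<and> star A (p v) = p v) \<and>
     (\<forall>v\<in>verts G. \<forall>w\<in>verts G. v \<noteq> w \<longrightarrow> p v \<otimes>\<^bsub>A\<^esub> p w = \<zero>\<^bsub>A\<^esub>) \<and>
     (\<forall>e\<in>arcs G. s e \<in> carrier A \<and> s e \<otimes>\<^bsub>A\<^esub> star A (s e) \<otimes>\<^bsub>A\<^esub> s e = s e) \<and>
     (\<forall>e\<in>arcs G. \<forall>f\<in>arcs G. e \<noteq> f \<longrightarrow>
        (s e \<otimes>\<^bsub>A\<^esub> star A (s e)) \<otimes>\<^bsub>A\<^esub> (s f \<otimes>\<^bsub>A\<^esub> star A (s f)) = \<zero>\<^bsub>A\<^esub>) \<and>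
     (\<forall>e\<in>arcs G. star A (s e) \<otimes>\<^bsub>A\<^esub> s e = p (head G e)) \<and>
     (\<forall>e\<in>arcs G. p (tail G e) \<otimes>\<^bsub>A\<^esub> (s e \<otimes>\<^bsub>A\<^esub> star A (s e)) = s e \<otimes>\<^bsub>A\<^esub> star A (s e)) \<and>
     (\<forall>v\<in>verts G. finite (out_arcs G v) \<and> out_arcs G v \<noteq> {} \<longrightarrow>
        p v = (\<Oplus>\<^bsub>A\<^esub>e\<in>out_arcs G v. s e \<otimes>\<^bsub>A\<^esub> star A (s e)))"

text \<open>Universality is tested against C*-algebras on the same type.\<close>

definition universal_cuntz_krieger ::
  "('v, 'e) pre_digraph \<Rightarrow> 'a cstar \<Rightarrow> ('v \<Rightarrow> 'a) \<Rightarrow> ('e \<Rightarrow> 'a) \<Rightarrow> bool" where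
  "universal_cuntz_krieger G A p s \<longleftrightarrow>
     cstar_algebra A \<and> cuntz_krieger_family G A p s \<and>
     (\<forall>S. closed_star_subalgebra S A \<and> p ` verts G \<subseteq> S \<and> s ` arcs G \<subseteq> S \<longrightarrow> S = carrier A) \<and>
     (\<forall>(B :: 'a cstar) q t. cstar_algebra B \<and> cuntz_krieger_family G B q t \<longrightarrow>
        (\<exists>\<phi>. star_hom A B \<phi> \<and> (\<forall>v\<in>verts G. \<phi> (p v) = q v) \<and> (\<forall>e\<in>arcs G. \<phi> (s e) = t e)))"

text \<open>For a countable graph every C*-algebra generated by a Cuntz-Krieger family is separable, so it
  has at most continuum many elements and a copy of it lives on \<^typ>\<open>nat \<Rightarrow> nat\<close>. Hence, on this type,
  \<^const>\<open>universal_cuntz_krieger\<close> is universality among all C*-algebras, and a universal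
  algebra exists; it is unique up to *-isomorphism, and one of them is chosen.\<close>

definition graph_cstar :: "('v, 'e) pre_digraph \<Rightarrow> (nat \<Rightarrow> nat) cstar" where
  "graph_cstar G = (SOME A. \<exists>p s. universal_cuntz_krieger G A p s)"


section \<open>Covers, posets and their graphs\<close>

definition open_cover :: "'a topology \<Rightarrow> 'a set set \<Rightarrow> bool" where
  "open_cover X p \<longleftrightarrow>
     (if topspace X = {} then p = {{}}
      else (\<forall>U\<in>p. openin X U) \<and> \<Union>p = topspace X \<and> {} \<notin> p)"

definition members_at :: "'a set set \<Rightarrow> 'a \<Rightarrow> 'a set set" where
  "members_at p x = {U \<in> p. x \<in> U}"

definition cover_quotient :: "'a topology \<Rightarrow> 'a set set \<Rightarrow> 'a set set" where
  "cover_quotient X p =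
     topspace X // {(x, y). x \<in> topspace X \<and> y \<in> topspace X \<and> members_at p x = members_at p y}"

definition class_le :: "'a set set \<Rightarrow> 'a set \<Rightarrow> 'a set \<Rightarrow> bool" where
  "class_le p C D \<longleftrightarrow> (\<exists>x\<in>C. \<exists>y\<in>D. members_at p x \<subseteq> members_at p y)"

definition class_less :: "'a set set \<Rightarrow> 'a set \<Rightarrow> 'a set \<Rightarrow> bool" where
  "class_less p C D \<longleftrightarrow> class_le p C D \<and> C \<noteq> D"

text \<open>For empty \<open>X\<close> the single vertex is (arbitrarily) named \<open>{}\<close>.\<close>

definition cover_graph :: "'a topology \<Rightarrow> 'a set set \<Rightarrow> ('a set, 'a set \<times> 'a set) pre_digraph" where
  "cover_graph X p =
     (if topspace X = {} then \<lparr>verts = {{}}, arcs = {}, tail = fst, head = snd\<rparr>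
      else \<lparr>verts = cover_quotient X p,
            arcs = {(C, D). C \<in> cover_quotient X p \<and> D \<in> cover_quotient X p \<and>
                     class_less p C D \<and>
                     \<not> (\<exists>E\<in>cover_quotient X p. class_less p C E \<and> class_less p E D)},
            tail = fst, head = snd\<rparr>)"

definition admissible_cover :: "'a topology \<Rightarrow> 'a set set \<Rightarrow> bool" where
  "admissible_cover X p \<longleftrightarrow> open_cover X p \<and> countable (cover_quotient X p)"

definition has_size :: "'a set \<Rightarrow> enat \<Rightarrow> bool" where
  "has_size S n \<longleftrightarrow>
     (case n of enat k \<Rightarrow> finite S \<and> card S = k | \<infinity> \<Rightarrow> countable S \<and> infinite S)"

definition admissible_covers :: "enat \<Rightarrow> 'a topology \<Rightarrow> 'a set set set" where
  "admissible_covers n X = {p. admissible_cover X p \<and> has_size p n}"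

definition cover_cstar :: "'a topology \<Rightarrow> 'a set set \<Rightarrow> (nat \<Rightarrow> nat) cstar" where
  "cover_cstar X p = graph_cstar (cover_graph X p)"


section \<open>The spaces \<open>Pg\<close> and weak local isomorphism\<close>

text \<open>The union of the \<open>Prim (A\<^sub>p)\<close> is disjoint, each point being tagged with its cover \<open>p\<close>.
  Weak local isomorphism is a relation between these unions together with their decompositions,
  and so it is stated in terms of \<open>X\<close>, \<open>Y\<close> and \<open>n\<close>.\<close>

definition Pg :: "enat \<Rightarrow> 'a topology \<Rightarrow>
    ('a set set \<times> (nat \<Rightarrow> nat) set, 'a set set \<times> (nat \<Rightarrow> nat) set \<Rightarrow> complex) cstar_space" where
  "Pg n X = Cb_space (topology_generated_by
     {Pair p ` U | p U. p \<in> admissible_covers n X \<and> openin (Prim_topology (cover_cstar X p)) U})"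

definition Pg_weakly_locally_isomorphic :: "enat \<Rightarrow> 'a topology \<Rightarrow> 'b topology \<Rightarrow> bool" where
  "Pg_weakly_locally_isomorphic n X Y \<longleftrightarrow>
     (\<forall>t\<in>admissible_covers n X. \<exists>p\<in>admissible_covers n Y.
        cstar_space_isomorphic (Prim_space (cover_cstar X t)) (Prim_space (cover_cstar Y p))) \<and>
     (\<forall>p\<in>admissible_covers n Y. \<exists>t\<in>admissible_covers n X.
        cstar_space_isomorphic (Prim_space (cover_cstar Y p)) (Prim_space (cover_cstar X t)))"

end

theory Submission
  imports Defs "Graph_Theory.Digraph_Isomorphism"
begin

text \<open>A homeomorphism \<open>f\<close> from \<open>X\<close> to \<open>Y\<close> carries a cover \<open>t\<close> of \<open>X\<close> to the cover of \<open>Y\<close> by the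
  sets \<open>f ` U\<close> with \<open>U \<in> t\<close>. It matches the points of \<open>X\<close> with those of \<open>Y\<close> in such a way that the
  inclusions among the sets \<open>members_at\<close> are preserved and reflected, so it induces an isomorphism
  of the quotient posets, hence of the graphs assigned to the two covers
  (\<open>digraph_iso_cover_graph\<close>), and the image cover is admissible and of the same size.

  A Cuntz-Krieger family for a graph is a Cuntz-Krieger family for every isomorphic graph after
  relabelling its indices. So isomorphic graphs have exactly the same universal
  C*-algebras, and the choice operator that selects the graph algebra returns one and the same
  algebra for both (\<open>graph_cstar_cong\<close>). The primitive ideal spaces of the two covers are thus
  equal, not only isomorphic, and the identity is the isomorphism wanted.\<close>

section \<open>Graph C*-algebras of isomorphic graphs\<close>

lemma cuntz_krieger_family_pullback:
  assumes hom: "pre_digraph.digraph_isomorphism G h"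
    and A: "cstar_algebra A"
    and ck: "cuntz_krieger_family (app_iso h G) A p s"
  shows "cuntz_krieger_family G A (p \<circ> iso_verts h) (s \<circ> iso_arcs h)"
proof -
  interpret wf_digraph G
    using hom by (simp add: pre_digraph.digraph_isomorphism_def)
  interpret A: cstar_algebra A by (rule A)
  let ?H = "app_iso h G"
  have s: "s e \<in> carrier A" if "e \<in> arcs ?H" for e
    using ck that unfolding cuntz_krieger_family_def by auto
  \<comment> \<open>The sum at a vertex is the only relation that is not termwise; its index set has to be
    carried along \<open>h\<close>.\<close>
  have sum: "p (iso_verts h v) =
      (\<Oplus>\<^bsub>A\<^esub>e\<in>out_arcs G v. s (iso_arcs h e) \<otimes>\<^bsub>A\<^esub> star A (s (iso_arcs h e)))"
    if v: "v \<in> verts G" and fin: "finite (out_arcs G v)" and ne: "out_arcs G v \<noteq> {}" for v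
  proof -
    have out: "out_arcs ?H (iso_verts h v) = iso_arcs h ` out_arcs G v"
      using hom v by (rule out_arcs_app_iso_eq)
    have "\<forall>w\<in>verts ?H. finite (out_arcs ?H w) \<and> out_arcs ?H w \<noteq> {} \<longrightarrow>
        p w = (\<Oplus>\<^bsub>A\<^esub>e\<in>out_arcs ?H w. s e \<otimes>\<^bsub>A\<^esub> star A (s e))"
      using ck unfolding cuntz_krieger_family_def by (elim conjE)
    then have "p (iso_verts h v) =
        (\<Oplus>\<^bsub>A\<^esub>e\<in>iso_arcs h ` out_arcs G v. s e \<otimes>\<^bsub>A\<^esub> star A (s e))"
      using v fin ne by (simp add: out)
    also have "\<dots> = (\<Oplus>\<^bsub>A\<^esub>e\<in>out_arcs G v. s (iso_arcs h e) \<otimes>\<^bsub>A\<^esub> star A (s (iso_arcs h e)))"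
    proof (rule A.finsum_reindex)
      show "(\<lambda>e. s e \<otimes>\<^bsub>A\<^esub> star A (s e)) \<in> iso_arcs h ` out_arcs G v \<rightarrow> carrier A"
        using s by (auto intro!: A.mult_closed A.star_closed)
      show "inj_on (iso_arcs h) (out_arcs G v)"
        using digraph_isomorphism_inj_on_arcs[OF hom] by (rule inj_on_subset) auto
    qed
    finally show ?thesis .
  qed
  show ?thesis
    unfolding cuntz_krieger_family_def o_apply
  proof (intro conjI[rotated])
    show "\<forall>v\<in>verts G. finite (out_arcs G v) \<and> out_arcs G v \<noteq> {} \<longrightarrow> p (iso_verts h v) =
      (\<Oplus>\<^bsub>A\<^esub>e\<in>out_arcs G v. s (iso_arcs h e) \<otimes>\<^bsub>A\<^esub> star A (s (iso_arcs h e)))"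
      using sum by blast
  qed (use ck in \<open>auto simp: cuntz_krieger_family_def iso_verts_tail[OF hom, symmetric]
      iso_verts_head[OF hom, symmetric] iso_verts_eq_iff[OF hom] iso_arcs_eq_iff[OF hom]\<close>)
qed

text \<open>Families are relabelled in both directions: along \<open>h\<close> for the generators, and along its
  inverse to turn a test family for \<open>G\<close> into one to which universality over the image applies.\<close>

lemma universal_cuntz_krieger_app_iso:
  assumes hom: "pre_digraph.digraph_isomorphism G h"
    and univ: "universal_cuntz_krieger (app_iso h G) A p s"
  shows "universal_cuntz_krieger G A (p \<circ> iso_verts h) (s \<circ> iso_arcs h)"
proof -
  interpret wf_digraph G
    using hom by (simp add: pre_digraph.digraph_isomorphism_def)
  let ?H = "app_iso h G" and ?k = "inv_iso h"
  have A: "cstar_algebra A" and ck: "cuntz_krieger_family ?H A p s"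
    and gen: "\<And>S. closed_star_subalgebra S A \<Longrightarrow> p ` verts ?H \<subseteq> S \<Longrightarrow> s ` arcs ?H \<subseteq> S
        \<Longrightarrow> S = carrier A"
    and lift: "\<And>(B :: 'e cstar) q t. cstar_algebra B \<Longrightarrow> cuntz_krieger_family ?H B q t \<Longrightarrow>
        \<exists>\<phi>. star_hom A B \<phi> \<and> (\<forall>v\<in>verts ?H. \<phi> (p v) = q v) \<and> (\<forall>e\<in>arcs ?H. \<phi> (s e) = t e)"
    using univ unfolding universal_cuntz_krieger_def by auto
  have lift': "\<exists>\<phi>. star_hom A B \<phi> \<and> (\<forall>v\<in>verts G. \<phi> (p (iso_verts h v)) = q v)
        \<and> (\<forall>e\<in>arcs G. \<phi> (s (iso_arcs h e)) = t e)"
    if B: "cstar_algebra B" and ckB: "cuntz_krieger_family G B q t" for B :: "'e cstar" and q t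
  proof -
    have "cuntz_krieger_family ?H B (q \<circ> iso_verts ?k) (t \<circ> iso_arcs ?k)"
      using digraph_isomorphism_invI[OF hom] B
      by (rule cuntz_krieger_family_pullback) (simp add: hom ckB)
    from lift[OF B this] show ?thesis
      using hom by auto
  qed
  show ?thesis
    unfolding universal_cuntz_krieger_def
    using A cuntz_krieger_family_pullback[OF hom A ck] gen lift' by (auto simp: image_comp)
qed

text \<open>An equality is possible because the graph algebra is chosen by a predicate that isomorphic
  graphs share.\<close>

lemma graph_cstar_cong:
  assumes "digraph_iso G H"
  shows "graph_cstar G = graph_cstar H"
proof -
  obtain h where hom: "pre_digraph.digraph_isomorphism G h" and H: "H = app_iso h G"
    using assms unfolding digraph_iso_def by blast
  interpret wf_digraph G
    using hom by (simp add: pre_digraph.digraph_isomorphism_def)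
  have inv: "pre_digraph.digraph_isomorphism H (inv_iso h)" "G = app_iso (inv_iso h) H"
    using digraph_isomorphism_invI[OF hom] hom by (simp_all add: H)
  have "(\<exists>p s. universal_cuntz_krieger G A p s) \<longleftrightarrow> (\<exists>p s. universal_cuntz_krieger H A p s)"
    for A :: "(nat \<Rightarrow> nat) cstar"
    using universal_cuntz_krieger_app_iso[OF hom] universal_cuntz_krieger_app_iso[OF inv(1)]
    unfolding H[symmetric] inv(2)[symmetric] by blast
  then show ?thesis
    by (simp add: graph_cstar_def)
qed

section \<open>Transport of covers along a homeomorphism\<close>

lemma map_prod_image_rel:
  assumes "\<And>x y. x \<in> Q \<Longrightarrow> y \<in> Q \<Longrightarrow> R' (g x) (g y) \<longleftrightarrow> R x y"
  shows "map_prod g g ` {(x, y). x \<in> Q \<and> y \<in> Q \<and> R x y}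
    = {(x, y). x \<in> g ` Q \<and> y \<in> g ` Q \<and> R' x y}"
  using assms by (auto simp: image_iff)

lemma open_cover_subsets: "open_cover X t \<Longrightarrow> t \<subseteq> Pow (topspace X)"
  by (auto simp: open_cover_def split: if_splits)

lemma open_cover_image:
  assumes f: "homeomorphic_map X Y f" and t: "open_cover X t"
  shows "open_cover Y ((`) f ` t)"
proof -
  have surj: "f ` topspace X = topspace Y"
    using f by (rule homeomorphic_imp_surjective_map)
  show ?thesis
  proof (cases "topspace X = {}")
    case True
    then show ?thesis using t surj by (auto simp: open_cover_def)
  next
    case False
    then have ne: "topspace Y \<noteq> {}" using surj by auto
    have opn: "openin Y (f ` U)" if "U \<in> t" for U
      using that t False homeomorphic_imp_open_map[OF f] by (simp add: open_cover_def open_map_def)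
    have "\<Union>((`) f ` t) = f ` \<Union>t" by auto
    then show ?thesis
      using t False ne opn surj by (auto simp: open_cover_def)
  qed
qed

text \<open>The poset of a cover is determined by which points lie in which members of the cover, so
  the hypotheses on \<open>f\<close> concern points alone.\<close>

locale cover_transport =
  fixes X :: "'a topology" and Y :: "'b topology" and f :: "'a \<Rightarrow> 'b" and t :: "'a set set"
  assumes inj: "inj_on f (topspace X)"
    and surj: "f ` topspace X = topspace Y"
    and subsets: "t \<subseteq> Pow (topspace X)"
begin

lemma inj_image: "inj_on ((`) f) (Pow (topspace X))"
  using inj by (rule inj_on_image_Pow)

lemma members_at_image:
  assumes "x \<in> topspace X"
  shows "members_at ((`) f ` t) (f x) = (`) f ` members_at t x"
proof -
  have "f x \<in> f ` U \<longleftrightarrow> x \<in> U" if "U \<in> t" for U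
    using that subsets assms inj by (meson PowD inj_on_image_mem_iff subsetD)
  then show ?thesis by (auto simp: members_at_def)
qed

lemma members_at_image_subset_iff:
  assumes "x \<in> topspace X" "y \<in> topspace X"
  shows "members_at ((`) f ` t) (f x) \<subseteq> members_at ((`) f ` t) (f y)
    \<longleftrightarrow> members_at t x \<subseteq> members_at t y"
proof -
  have "members_at t z \<subseteq> Pow (topspace X)" for z
    using subsets by (auto simp: members_at_def)
  then show ?thesis
    by (simp add: members_at_image assms inj_on_image_subset_iff[OF inj_image])
qed

lemma members_at_image_eq_iff:
  assumes "x \<in> topspace X" "y \<in> topspace X"
  shows "members_at ((`) f ` t) (f x) = members_at ((`) f ` t) (f y)
    \<longleftrightarrow> members_at t x = members_at t y"
  using assms by (simp add: set_eq_subset members_at_image_subset_iff)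

lemma cover_quotient_image: "cover_quotient Y ((`) f ` t) = (`) f ` cover_quotient X t"
proof -
  define r where "r = {(x, y). x \<in> topspace X \<and> y \<in> topspace X \<and> members_at t x = members_at t y}"
  define r' where "r' = {(x, y). x \<in> topspace Y \<and> y \<in> topspace Y \<and>
      members_at ((`) f ` t) x = members_at ((`) f ` t) y}"
  have "r' `` {f x} = f ` (r `` {x})" if x: "x \<in> topspace X" for x
  proof -
    have "r' `` {f x} =
        f ` {z \<in> topspace X. members_at ((`) f ` t) (f x) = members_at ((`) f ` t) (f z)}"
      using x by (auto simp: r'_def surj[symmetric])
    also have "\<dots> = f ` {z \<in> topspace X. members_at t x = members_at t z}"
      using x members_at_image_eq_iff by (metis (no_types, lifting))
    also have "\<dots> = f ` (r `` {x})"
      using x by (simp add: r_def Image_def)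
    finally show ?thesis .
  qed
  then have "topspace Y // r' = (`) f ` (topspace X // r)"
    by (auto simp: quotient_def surj[symmetric] image_UN)
  then show ?thesis
    by (simp add: cover_quotient_def r_def r'_def)
qed

lemma cover_quotient_subsets: "cover_quotient X t \<subseteq> Pow (topspace X)"
  by (auto simp: cover_quotient_def quotient_def)

lemma class_less_image_iff:
  assumes "C \<in> cover_quotient X t" "D \<in> cover_quotient X t"
  shows "class_less ((`) f ` t) (f ` C) (f ` D) \<longleftrightarrow> class_less t C D"
proof -
  have sub: "C \<subseteq> topspace X" "D \<subseteq> topspace X"
    using assms cover_quotient_subsets by auto
  then have "x \<in> C \<Longrightarrow> x \<in> topspace X" "x \<in> D \<Longrightarrow> x \<in> topspace X" for x
    by auto
  then have "class_le ((`) f ` t) (f ` C) (f ` D) \<longleftrightarrow> class_le t C D"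
    by (simp add: class_le_def members_at_image_subset_iff cong: bex_cong)
  moreover have "f ` C = f ` D \<longleftrightarrow> C = D"
    using inj sub by (simp add: inj_on_image_eq_iff)
  ultimately show ?thesis by (simp add: class_less_def)
qed

lemma digraph_iso_cover_graph: "digraph_iso (cover_graph X t) (cover_graph Y ((`) f ` t))"
proof -
  let ?h = "\<lparr>iso_verts = (`) f, iso_arcs = map_prod ((`) f) ((`) f), iso_head = snd, iso_tail = fst\<rparr>"
  let ?G = "cover_graph X t"
  have empty_iff: "topspace Y = {} \<longleftrightarrow> topspace X = {}"
    by (metis image_is_empty surj)
  have arcs_sub: "arcs ?G \<subseteq> verts ?G \<times> verts ?G"
    by (auto simp: cover_graph_def)
  have verts_sub: "verts ?G \<subseteq> Pow (topspace X)"
    using cover_quotient_subsets by (auto simp: cover_graph_def)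
  have ends: "tail ?G = fst" "head ?G = snd"
    by (auto simp: cover_graph_def)
  have injv: "inj_on ((`) f) (verts ?G)"
    using inj_image verts_sub by (rule inj_on_subset)
  then have "inj_on (map_prod ((`) f) ((`) f)) (arcs ?G)"
    by (rule inj_on_subset[OF map_prod_inj_on[OF _ injv] arcs_sub])
  moreover have "wf_digraph ?G"
    using arcs_sub by (auto simp: wf_digraph_def ends)
  ultimately have "pre_digraph.digraph_isomorphism ?G ?h"
    using injv by (simp add: pre_digraph.digraph_isomorphism_def ends)
  moreover have "cover_graph Y ((`) f ` t) = app_iso ?h ?G"
  proof (cases "topspace X = {}")
    case True
    then have "topspace Y = {}" by (simp only: empty_iff)
    with True show ?thesis by (simp add: cover_graph_def app_iso_def)
  next
    case False
    then have ne: "topspace Y \<noteq> {}" by (simp only: empty_iff not_False_eq_True)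
    have "arcs (cover_graph Y ((`) f ` t)) = map_prod ((`) f) ((`) f) ` arcs ?G"
      using False ne
      by (simp add: cover_graph_def cover_quotient_image)
         (rule map_prod_image_rel[symmetric], simp add: class_less_image_iff)
    then show ?thesis
      using False ne by (simp add: cover_graph_def app_iso_def cover_quotient_image)
  qed
  ultimately show ?thesis
    unfolding digraph_iso_def by blast
qed

lemma cover_cstar_image: "cover_cstar Y ((`) f ` t) = cover_cstar X t"
  using graph_cstar_cong[OF digraph_iso_cover_graph] by (simp add: cover_cstar_def)

lemma has_size_image: "has_size ((`) f ` t) n \<longleftrightarrow> has_size t n"
proof -
  have "inj_on ((`) f) t"
    using inj_image subsets by (rule inj_on_subset)
  then show ?thesis
    by (auto simp: has_size_def finite_image_iff card_image countable_image_inj_eq split: enat.split)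
qed

end

lemma admissible_covers_image:
  assumes f: "homeomorphic_map X Y f" and t: "t \<in> admissible_covers n X"
  shows "(`) f ` t \<in> admissible_covers n Y"
    and "cover_cstar Y ((`) f ` t) = cover_cstar X t"
proof -
  have cov: "open_cover X t" and adm: "countable (cover_quotient X t)" "has_size t n"
    using t by (auto simp: admissible_covers_def admissible_cover_def)
  interpret cover_transport X Y f t
    using homeomorphic_imp_injective_map[OF f] homeomorphic_imp_surjective_map[OF f]
      open_cover_subsets[OF cov] by unfold_locales
  show "(`) f ` t \<in> admissible_covers n Y"
    using open_cover_image[OF f cov] adm
    by (simp add: admissible_covers_def admissible_cover_def cover_quotient_image has_size_image)
  show "cover_cstar Y ((`) f ` t) = cover_cstar X t"
    by (rule cover_cstar_image)
qed

section \<open>Weak local isomorphism\<close>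

lemma cstar_space_isomorphic_refl: "cstar_space_isomorphic S S"
proof -
  have pre: "preimg S id V = V" if "openin (base S) V" for V
    using openin_subset[OF that] by auto
  have "cstar_space_morphism S S id (\<lambda>V. id)"
    using pre by (auto simp: cstar_space_morphism_def star_hom_def)
  then show ?thesis
    unfolding cstar_space_isomorphic_def by (intro exI[of _ id] exI[of _ "\<lambda>V. id"]) auto
qed

theorem mainTheorem3:
  fixes X :: "'a topology" and Y :: "'b topology"
  assumes "X homeomorphic_space Y"
  shows "\<forall>n::enat. n \<noteq> 0 \<longrightarrow> Pg_weakly_locally_isomorphic n X Y"
proof -
  obtain f where f: "homeomorphic_map X Y f"
    using assms by (auto simp: homeomorphic_space)
  obtain g where g: "homeomorphic_map Y X g"
    using assms homeomorphic_space_sym homeomorphic_space by metis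
  show ?thesis
    unfolding Pg_weakly_locally_isomorphic_def
    by (metis admissible_covers_image[OF f] admissible_covers_image[OF g]
        cstar_space_isomorphic_refl)
qed

end
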